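(* Let $(L,\preceq)$ be a meet semilattice with $n$ elements. Assume that there exist elements $x,y_1,\ldots,y_m$ in $L$ with $m\ge 2$ such that $x$ covers $y_1,\ldots,y_m$ and $\mu_L(y,x)>0$, where $y=y_1\wedge\cdots\wedge y_m$. Then there exist a set $S=\{x_1,x_2,\ldots,x_n\}$ of $n$ distinct positive integers and a positive real number $\alpha_0$ such that $(S,\mid)\cong(L,\preceq)$ as posets and the power LCM matrix $[S]_{N^{\alpha_0}}$, i.e. the $n\times n$ matrix whose $(i,j)$-entry is $\mathrm{lcm}(x_i,x_j)^{\alpha_0}$, is singular.
   Context: $(S,\mid)$ denotes $S$ partially ordered by divisibility. In a poset, $x$ covers $y$ if $y\prec x$ and there is no $w$ with $y\prec w\prec x$. $\mu_L$ denotes the Möbius function of the finite poset $L$: $\mu_L(u,u)=1$, $\mu_L(u,v)=-\sum_{u\preceq w\prec v}\mu_L(u,w)$ for $u\prec v$, and $\mu_L(u,v)=0$ if $u\not\preceq v$. *)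

theory Defs
  imports Complex_Main "HOL-Library.Cardinality" "Jordan_Normal_Form.Matrix"
begin

definition covers :: "'a::order \<Rightarrow> 'a \<Rightarrow> bool" where
  "covers x y \<longleftrightarrow> y < x \<and> \<not> (\<exists>w. y < w \<and> w < x)"

function mobius :: "'a::{order,finite} \<Rightarrow> 'a \<Rightarrow> int" where
  "mobius u v =
     (if u = v then 1
      else if u < v then - (\<Sum>w\<in>{u..<v}. mobius u w)
      else 0)"
  by auto
termination
proof (relation "measure (\<lambda>(u, v). card {..<v})")
  show "wf (measure (\<lambda>(u::'a, v::'a). card {..<v}))"
    by simp
next
  fix u v w :: 'a
  assume "w \<in> {u..<v}"
  then have "{..<w} \<subset> {..<v}"
    by auto
  then show "((u, w), (u, v)) \<in> measure (\<lambda>(u, v). card {..<v})"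
    by (simp add: psubset_card_mono)
qed

text \<open>The recursive equation loops as a rewrite rule.\<close>
declare mobius.simps [simp del]

definition poset_isomorphic ::
    "'a set \<Rightarrow> ('a \<Rightarrow> 'a \<Rightarrow> bool) \<Rightarrow> 'b set \<Rightarrow> ('b \<Rightarrow> 'b \<Rightarrow> bool) \<Rightarrow> bool" where
  "poset_isomorphic A leA B leB \<longleftrightarrow>
     (\<exists>f. bij_betw f A B \<and> (\<forall>a\<in>A. \<forall>a'\<in>A. leA a a' \<longleftrightarrow> leB (f a) (f a')))"

text \<open>Matrix indices, and hence the enumeration of \<open>S\<close>, start at 0.\<close>
definition power_lcm_matrix :: "nat \<Rightarrow> (nat \<Rightarrow> nat) \<Rightarrow> real \<Rightarrow> real mat" where
  "power_lcm_matrix n s \<alpha> = mat n n (\<lambda>(i, j). real (lcm (s i) (s j)) powr \<alpha>)"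

end

theory Submission
  imports Defs "HOL-Computational_Algebra.Primes" "HOL-Library.Infinite_Set"
begin

text \<open>
  Attach distinct primes \<open>p\<^sub>w\<close> to the elements of the semilattice and put
  \<open>f z = (\<Prod>w\<le>z. p\<^sub>w ^ a\<^sub>w)\<close>, so that \<open>gcd (f i) (f j) = f (inf i j)\<close>. If
  \<open>\<Psi> \<alpha> = (\<Sum>j\<le>x. \<mu>(j, x) f(j) powr - \<alpha>)\<close> vanishes, then \<open>\<mu>(j, x) f(j) powr - \<alpha>\<close>
  is a kernel vector of the power LCM matrix. By Moebius inversion, \<open>\<Psi>\<close> vanishes at 0 with
  derivative \<open>- a\<^sub>x ln p\<^sub>x < 0\<close>. Take \<open>a\<^sub>w = K\<close> at two distinct elements \<open>y\<^sub>1\<close>, \<open>y\<^sub>2\<close> covered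
  by \<open>x\<close> and \<open>a\<^sub>w = 1\<close> elsewhere: as \<open>K\<close> grows, \<open>\<Psi> (1 / K)\<close> tends to
  \<open>(1 - 1 / p\<^bsub>y\<^sub>1\<^esub>) (1 - 1 / p\<^bsub>y\<^sub>2\<^esub>) > 0\<close>, so \<open>\<Psi>\<close> has a positive zero. Two distinct
  covered elements exist because \<open>\<mu>(y, x) = - 1\<close> if all the \<open>y\<^sub>i\<close> coincide.
\<close>

section \<open>Moebius inversion over down-sets\<close>

lemma mobius_refl [simp]: "mobius u u = 1"
  by (simp add: mobius.simps[of u u])

lemma mobius_eq_0: "\<not> u \<le> v \<Longrightarrow> mobius u v = 0"
  by (auto simp: mobius.simps[of u v])

lemma sum_mobius:
  fixes j x :: "'a::{order,finite}"
  shows "(\<Sum>z\<in>{j..x}. mobius j z) = (if j = x then 1 else 0)"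
proof (cases "j < x")
  case True
  then have "{j..x} = insert x {j..<x}" by auto
  then show ?thesis
    using True by (simp add: mobius.simps[of j x])
next
  case False
  then have "{j..x} = (if j = x then {x} else {})" by auto
  then show ?thesis by auto
qed

lemma sum_mobius_transform:
  fixes x :: "'a::{order,finite}" and h :: "'a \<Rightarrow> real"
  shows "(\<Sum>z\<le>x. \<Sum>j\<le>z. of_int (mobius j z) * h j) = h x"
proof -
  have "(\<Sum>z\<le>x. \<Sum>j\<le>z. of_int (mobius j z) * h j) =
      (\<Sum>z\<in>{..x}. \<Sum>j | j \<in> UNIV \<and> j \<le> z. of_int (mobius j z) * h j)"
    by (simp add: atMost_def)
  also have "\<dots> = (\<Sum>j\<in>UNIV. \<Sum>z | z \<in> {..x} \<and> j \<le> z. of_int (mobius j z) * h j)"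
    by (rule sum.swap_restrict) auto
  also have "\<dots> = (\<Sum>j\<in>UNIV. of_int (\<Sum>z\<in>{j..x}. mobius j z) * h j)"
    by (intro sum.cong refl) (auto simp: sum_distrib_right intro!: sum.cong)
  also have "\<dots> = (\<Sum>j\<in>UNIV. if j = x then h j else 0)"
    by (intro sum.cong refl) (simp add: sum_mobius)
  finally show ?thesis by simp
qed

text \<open>Induction on the number of elements strictly below \<open>x\<close>. This injectivity
  turns the one-sided inverse given by \<open>sum_mobius_transform\<close> into a two-sided
  one.\<close>

lemma sum_atMost_eq_imp_eq:
  fixes k k' :: "'a::{order,finite} \<Rightarrow> real"
  assumes "\<And>z. (\<Sum>w\<le>z. k w) = (\<Sum>w\<le>z. k' w)"
  shows "k = k'"
proof
  fix x
  show "k x = k' x"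
  proof (induction x rule: measure_induct_rule[where f = "\<lambda>z. card {..<z}"])
    case (less x)
    have "k w = k' w" if "w < x" for w
    proof (rule less)
      show "card {..<w} < card {..<x}"
        using that by (intro psubset_card_mono) auto
    qed
    then have "(\<Sum>w<x. k w) = (\<Sum>w<x. k' w)" by simp
    moreover have "{..x} = insert x {..<x}" by auto
    ultimately show ?case using assms[of x] by simp
  qed
qed

text \<open>The recursion for \<open>mobius\<close> runs over the second argument, whereas here the
  first one varies. Both sides, as functions of \<open>x\<close>, have the same down-set sums by
  \<open>sum_mobius_transform\<close>, so they agree.\<close>

lemma mobius_inversion:
  fixes x :: "'a::{order,finite}" and k :: "'a \<Rightarrow> real"
  shows "(\<Sum>j\<le>x. of_int (mobius j x) * (\<Sum>w\<le>j. k w)) = k x"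
  using sum_atMost_eq_imp_eq[of "\<lambda>x. \<Sum>j\<le>x. of_int (mobius j x) * (\<Sum>w\<le>j. k w)" k]
  by (simp add: sum_mobius_transform fun_eq_iff)

text \<open>As a function of \<open>j\<close>, \<open>h (inf a j)\<close> is the down-set sum of the
  transform of \<open>h\<close> cut off outside \<open>{..a}\<close>; inversion returns the value of
  that cut-off at \<open>x\<close>.\<close>

lemma sum_mobius_inf:
  fixes a x :: "'a::{semilattice_inf,finite}" and h :: "'a \<Rightarrow> real"
  assumes "\<not> x \<le> a"
  shows "(\<Sum>j\<le>x. of_int (mobius j x) * h (inf a j)) = 0"
proof -
  define k where "k w = (if w \<le> a then (\<Sum>i\<le>w. of_int (mobius i w) * h i) else 0)" for w
  have "(\<Sum>w\<le>j. k w) = h (inf a j)" for j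
  proof -
    have "(\<Sum>w\<le>j. k w) = (\<Sum>w\<le>inf a j. \<Sum>i\<le>w. of_int (mobius i w) * h i)"
      unfolding k_def by (rule sum.mono_neutral_cong_right) auto
    then show ?thesis by (simp add: sum_mobius_transform)
  qed
  then show ?thesis
    using mobius_inversion[of x k] assms by (simp add: k_def)
qed

section \<open>A kernel vector of the power LCM matrix\<close>

lemma not_invertible_mat_if_kernel:
  fixes A :: "real mat"
  assumes A: "A \<in> carrier_mat n n" and v: "v \<in> carrier_vec n"
    and "v \<noteq> 0\<^sub>v n" and "A *\<^sub>v v = 0\<^sub>v n"
  shows "\<not> invertible_mat A"
proof
  assume "invertible_mat A"
  then obtain B where B: "A * B = 1\<^sub>m (dim_row A)" "B * A = 1\<^sub>m (dim_row B)"
    unfolding invertible_mat_def inverts_mat_def by auto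
  have dims: "dim_row B = n" "dim_col B = n"
    using arg_cong[OF B(1), of dim_col] arg_cong[OF B(2), of dim_col] A by auto
  then have "B \<in> carrier_mat n n" by auto
  then have "v = (B * A) *\<^sub>v v" using B dims v by simp
  also have "\<dots> = B *\<^sub>v (A *\<^sub>v v)"
    using \<open>B \<in> carrier_mat n n\<close> A v by simp
  also have "\<dots> = 0\<^sub>v n"
    using \<open>B \<in> carrier_mat n n\<close> assms(4) by auto
  finally show False using assms(3) by simp
qed

lemma power_lcm_matrix_not_invertible:
  fixes f :: "'a::{semilattice_inf,finite} \<Rightarrow> nat"
  assumes e: "bij_betw e {..<n} (UNIV :: 'a set)"
    and pos: "\<And>z. 0 < f z"
    and gcd: "\<And>i j. gcd (f i) (f j) = f (inf i j)"
    and zero: "(\<Sum>j\<le>x. of_int (mobius j x) * real (f j) powr - \<alpha>) = 0"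
  shows "\<not> invertible_mat (power_lcm_matrix n (f \<circ> e) \<alpha>)"
proof -
  define c where "c j = of_int (mobius j x) * real (f j) powr - \<alpha>" for j
  define v where "v = vec n (\<lambda>j. c (e j))"
  \<comment> \<open>Since gcd times lcm is the product, \<open>f j powr \<alpha>\<close> cancels
    against the factor in \<open>c j\<close>, leaving \<open>j\<close> only in the Moebius value and
    in the meet.\<close>
  have lcm: "real (lcm (f i) (f j)) powr \<alpha> * c j =
      real (f i) powr \<alpha> * (of_int (mobius j x) * real (f (inf i j)) powr - \<alpha>)" for i j
  proof -
    have "real (f i) * real (f j) = real (f (inf i j)) * real (lcm (f i) (f j))"
      by (metis gcd of_nat_mult prod_gcd_lcm_nat)
    then have "real (f i) powr \<alpha> * real (f j) powr \<alpha> =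
        real (f (inf i j)) powr \<alpha> * real (lcm (f i) (f j)) powr \<alpha>"
      by (metis powr_mult)
    then show ?thesis
      using pos[of j] pos[of "inf i j"] by (simp add: c_def powr_minus field_simps)
  qed
  have row: "(\<Sum>j\<in>UNIV. real (lcm (f i) (f j)) powr \<alpha> * c j) = 0" for i
  proof -
    have "(\<Sum>j\<in>UNIV. real (lcm (f i) (f j)) powr \<alpha> * c j) =
        (\<Sum>j\<le>x. real (lcm (f i) (f j)) powr \<alpha> * c j)"
      by (rule sum.mono_neutral_right) (auto simp: c_def mobius_eq_0)
    also have "\<dots> = real (f i) powr \<alpha> *
        (\<Sum>j\<le>x. of_int (mobius j x) * real (f (inf i j)) powr - \<alpha>)"
      by (simp add: lcm sum_distrib_left)
    also have "(\<Sum>j\<le>x. of_int (mobius j x) * real (f (inf i j)) powr - \<alpha>) = 0"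
    \<comment> \<open>For rows \<open>i\<close> above \<open>x\<close> the meets are the
      \<open>j\<close> themselves and the sum is \<open>zero\<close>; all other rows vanish for any
      function of the meet.\<close>
    proof (cases "x \<le> i")
      case True
      then have "inf i j = j" if "j \<le> x" for j
        using that by (meson inf.absorb2 order_trans)
      then show ?thesis using zero by simp
    next
      case False
      then show ?thesis by (rule sum_mobius_inf)
    qed
    finally show ?thesis by simp
  qed
  show ?thesis
  proof (rule not_invertible_mat_if_kernel)
    show "power_lcm_matrix n (f \<circ> e) \<alpha> \<in> carrier_mat n n" and "v \<in> carrier_vec n"
      by (simp_all add: power_lcm_matrix_def v_def)
    obtain i where "i < n" "e i = x"
      using e by (metis UNIV_I bij_betw_iff_bijections lessThan_iff)
    then have "v $ i \<noteq> 0" using pos[of x] by (simp add: v_def c_def)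
    then show "v \<noteq> 0\<^sub>v n" using \<open>i < n\<close> by auto
    have "(\<Sum>j<n. real (lcm (f (e i)) (f (e j))) powr \<alpha> * c (e j)) = 0" for i
      using sum.reindex_bij_betw[OF e, of "\<lambda>j. real (lcm (f (e i)) (f j)) powr \<alpha> * c j"] row
      by simp
    then show "power_lcm_matrix n (f \<circ> e) \<alpha> *\<^sub>v v = 0\<^sub>v n"
      by (intro eq_vecI)
        (auto simp: power_lcm_matrix_def v_def scalar_prod_def atLeast0LessThan)
  qed
qed

section \<open>Embedding the semilattice into divisibility\<close>

lemma ex_inj_primes: "\<exists>p :: 'a::finite \<Rightarrow> nat. inj p \<and> (\<forall>w. prime (p w))"
proof -
  obtain e :: "'a \<Rightarrow> nat" where "inj e"
    using finite_imp_inj_to_nat_seg[of "UNIV :: 'a set"] by auto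
  then have "inj (\<lambda>w. enumerate {q::nat. prime q} (e w))"
    using bij_enumerate[OF primes_infinite]
    by (simp add: inj_on_def bij_betw_def)
  moreover have "prime (enumerate {q::nat. prime q} i)" for i
    using enumerate_in_set[OF primes_infinite] by simp
  ultimately show ?thesis by blast
qed

text \<open>Both products contain the factor over \<open>{..inf i j}\<close>, the intersection of
  the two down-sets; the cofactors run over disjoint index sets and are coprime.\<close>

lemma gcd_prod_atMost:
  fixes q :: "'a::{semilattice_inf,finite} \<Rightarrow> nat"
  assumes "\<And>v w. v \<noteq> w \<Longrightarrow> coprime (q v) (q w)"
  shows "gcd (\<Prod>w\<le>i. q w) (\<Prod>w\<le>j. q w) = (\<Prod>w\<le>inf i j. q w)"
proof -
  have split: "(\<Prod>w\<le>i. q w) = (\<Prod>w\<le>inf i j. q w) * (\<Prod>w\<in>{..i} - {..j}. q w)" for i j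
  proof -
    have "{..i} = {..inf i j} \<union> ({..i} - {..j})" by auto
    moreover have "{..inf i j} \<inter> ({..i} - {..j}) = {}" by auto
    ultimately show ?thesis by (metis finite prod.union_disjoint)
  qed
  have "coprime (\<Prod>w\<in>{..i} - {..j}. q w) (\<Prod>w\<in>{..j} - {..i}. q w)"
    by (intro prod_coprime_left prod_coprime_right assms) auto
  then show ?thesis
    using split[of i j] split[of j i] by (simp add: inf_commute gcd_mult_left)
qed

lemma prod_prime_powers_dvd_iff:
  fixes p :: "'a::{order,finite} \<Rightarrow> nat"
  assumes "inj p" "\<And>w. prime (p w)" "\<And>w. 0 < a w"
  shows "(\<Prod>w\<le>i. p w ^ a w) dvd (\<Prod>w\<le>j. p w ^ a w) \<longleftrightarrow> i \<le> j"
proof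
  assume "i \<le> j"
  then show "(\<Prod>w\<le>i. p w ^ a w) dvd (\<Prod>w\<le>j. p w ^ a w)"
    by (intro prod_dvd_prod_subset) auto
next
  assume "(\<Prod>w\<le>i. p w ^ a w) dvd (\<Prod>w\<le>j. p w ^ a w)"
  moreover have "p i dvd p i ^ a i"
    using assms(3)[of i] by (intro dvd_power) simp
  moreover have "p i ^ a i dvd (\<Prod>w\<le>i. p w ^ a w)"
    by (intro dvd_prodI) auto
  ultimately have "p i dvd (\<Prod>w\<le>j. p w ^ a w)" by (meson dvd_trans)
  then obtain w where "w \<le> j" "p i dvd p w ^ a w"
    using assms(2)[of i] by (auto simp: prime_dvd_prod_iff)
  then have "p i = p w"
    using assms(2) by (meson prime_dvd_power primes_dvd_imp_eq)
  then show "i \<le> j" using assms(1) \<open>w \<le> j\<close> by (simp add: inj_eq)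
qed

text \<open>With \<open>l w = ln (p w)\<close> this is the sum \<Psi> at \<open>t / K\<close>:
  dividing the exponents \<open>K\<close> and 1 by \<open>K\<close> gives the weights 1 and
  \<open>1 / K\<close>, so the limit in \<open>K\<close> only replaces \<open>1 / K\<close> by
  0.\<close>

lemma sum_mobius_exp_root:
  fixes x y\<^sub>1 y\<^sub>2 :: "'a::{semilattice_inf,finite}" and l :: "'a \<Rightarrow> real"
  assumes cov: "covers x y\<^sub>1" "covers x y\<^sub>2" "y\<^sub>1 \<noteq> y\<^sub>2" and l: "\<And>w. 0 < l w"
  obtains K :: nat and t :: real where "0 < K" "0 < t"
    "(\<Sum>j\<le>x. of_int (mobius j x) *
        exp (- t * (\<Sum>w\<le>j. (if w \<in> {y\<^sub>1, y\<^sub>2} then 1 else inverse (real K)) * l w))) = 0"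
proof -
  define F where "F \<delta> t = (\<Sum>j\<le>x. of_int (mobius j x) *
      exp (- t * (\<Sum>w\<le>j. (if w \<in> {y\<^sub>1, y\<^sub>2} then 1 else \<delta>) * l w)))" for \<delta> t :: real
  have lt: "y\<^sub>1 < x" "y\<^sub>2 < x" using cov by (auto simp: covers_def)
  have above: "y\<^sub>1 \<le> j \<and> y\<^sub>2 \<le> j \<longleftrightarrow> x = j" if "j \<le> x" for j
    using cov that unfolding covers_def
    by (metis order.strict_iff_order)
  \<comment> \<open>The bottom element: the point mass \<open>d b\<close> has the constant 1 as its
    down-set sums.\<close>
  define b :: 'a where "b = Inf_fin UNIV"
  have b: "b \<le> j" for j by (simp add: b_def Inf_fin.coboundedI)
  have bx: "b \<noteq> x" using b[of y\<^sub>1] lt by auto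
  define d where "d u w = (if w = u then 1 else 0 :: real)" for u w :: 'a
  have d: "(\<Sum>w\<le>j. d u w) = (if u \<le> j then 1 else 0)" for u j
    by (simp add: d_def)

  have F0: "F \<delta> 0 = 0" for \<delta>
    using mobius_inversion[of x "d b"] bx by (simp add: F_def d b d_def)
  have F1: "F 0 1 > 0"
  proof -
    define e where "e u = 1 - exp (- l u)" for u
    have epos: "0 < e u" for u using l[of u] by (simp add: e_def)
    txt \<open>On \<open>{..x}\<close> the exponential is \<open>(1 - e y\<^sub>1 [y\<^sub>1 \<le> j]) (1 - e y\<^sub>2 [y\<^sub>2 \<le> j])\<close>, and only
      \<open>x\<close> lies above both \<open>y\<^sub>1\<close> and \<open>y\<^sub>2\<close>.\<close>
    define k where "k w = d b w - e y\<^sub>1 * d y\<^sub>1 w - e y\<^sub>2 * d y\<^sub>2 w + e y\<^sub>1 * e y\<^sub>2 * d x w" for w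
    have "exp (- 1 * (\<Sum>w\<le>j. (if w \<in> {y\<^sub>1, y\<^sub>2} then 1 else 0) * l w)) = (\<Sum>w\<le>j. k w)"
      if j: "j \<le> x" for j
    proof -
      have "(\<Sum>w\<le>j. (if w \<in> {y\<^sub>1, y\<^sub>2} then 1 else 0) * l w) =
          (\<Sum>w\<le>j. l y\<^sub>1 * d y\<^sub>1 w + l y\<^sub>2 * d y\<^sub>2 w)"
        using cov(3) by (intro sum.cong) (auto simp: d_def)
      also have "\<dots> = l y\<^sub>1 * (if y\<^sub>1 \<le> j then 1 else 0) + l y\<^sub>2 * (if y\<^sub>2 \<le> j then 1 else 0)"
        by (simp only: sum.distrib sum_distrib_left[symmetric] d)
      finally have lhs: "(\<Sum>w\<le>j. (if w \<in> {y\<^sub>1, y\<^sub>2} then 1 else 0) * l w) =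
          l y\<^sub>1 * (if y\<^sub>1 \<le> j then 1 else 0) + l y\<^sub>2 * (if y\<^sub>2 \<le> j then 1 else 0)" .
      have "x \<le> j \<longleftrightarrow> y\<^sub>1 \<le> j \<and> y\<^sub>2 \<le> j" using above[OF j] j by auto
      then have rhs: "(\<Sum>w\<le>j. k w) = 1 - e y\<^sub>1 * (if y\<^sub>1 \<le> j then 1 else 0)
          - e y\<^sub>2 * (if y\<^sub>2 \<le> j then 1 else 0)
          + e y\<^sub>1 * e y\<^sub>2 * (if y\<^sub>1 \<le> j \<and> y\<^sub>2 \<le> j then 1 else 0)"
        by (simp only: k_def sum.distrib sum_subtractf sum_distrib_left[symmetric] d b if_True)
      show ?thesis unfolding lhs rhs
        by (auto simp: e_def algebra_simps exp_add[symmetric])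
    qed
    then have "F 0 1 = (\<Sum>j\<le>x. of_int (mobius j x) * (\<Sum>w\<le>j. k w))"
      unfolding F_def by (intro sum.cong) auto
    \<comment> \<open>Inversion reads off \<open>k x\<close>, where only the last point mass
      contributes because \<open>b\<close>, \<open>y\<^sub>1\<close> and \<open>y\<^sub>2\<close>
      differ from \<open>x\<close>.\<close>
    also have "\<dots> = e y\<^sub>1 * e y\<^sub>2"
      using mobius_inversion[of x k] bx lt by (auto simp: k_def d_def)
    finally show ?thesis using epos by simp
  qed

  have "((\<lambda>K. F (inverse (real K)) 1) \<longlongrightarrow> F 0 1) sequentially"
    unfolding F_def
    by (intro tendsto_intros tendsto_exp) (auto intro!: tendsto_eq_intros lim_inverse_n)
  then have "eventually (\<lambda>K. F (inverse (real K)) 1 > 0) sequentially"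
    using F1 by (rule order_tendstoD)
  then have "eventually (\<lambda>K. F (inverse (real K)) 1 > 0 \<and> 0 < K) sequentially"
    using eventually_gt_at_top[of 0] by eventually_elim simp
  then obtain K :: nat where K: "F (inverse (real K)) 1 > 0" "0 < K"
    using eventually_happens'[OF sequentially_bot] by blast
  define \<delta> where "\<delta> = inverse (real K)"
  define c where "c w = (if w \<in> {y\<^sub>1, y\<^sub>2} then 1 else \<delta>) * l w" for w
  have "(F \<delta> has_real_derivative (\<Sum>j\<le>x. of_int (mobius j x) * - (\<Sum>w\<le>j. c w))) (at 0)"
    unfolding F_def c_def[symmetric]
    by (auto intro!: derivative_eq_intros sum.cong)
  \<comment> \<open>The derivative of each exponential at 0 is minus a down-set sum of
    \<open>c\<close>, so inversion applies again.\<close>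
  also have "(\<Sum>j\<le>x. of_int (mobius j x) * - (\<Sum>w\<le>j. c w)) = - c x"
    using mobius_inversion[of x c] by (simp add: sum_negf)
  finally have "(F \<delta> has_real_derivative - c x) (at 0)" .
  moreover have "- c x < 0" using l[of x] K by (simp add: c_def \<delta>_def)
  ultimately obtain r where r: "0 < r" "\<And>h. 0 < h \<Longrightarrow> h < r \<Longrightarrow> F \<delta> (0 + h) < F \<delta> 0"
    using DERIV_neg_dec_right by blast
  \<comment> \<open>A left endpoint within the range of descent and below 1, keeping the zero found
    on \<open>{h..1}\<close> away from the trivial one at 0.\<close>
  define h where "h = min (r / 2) (1 / 2)"
  have h: "0 < h" "h < r" "h \<le> 1" using r(1) by (auto simp: h_def)
  have "F \<delta> h \<le> 0" using r(2)[OF h(1,2)] F0 by simp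
  moreover have "continuous_on {h..1} (F \<delta>)"
    unfolding F_def by (intro continuous_intros)
  ultimately obtain t where "h \<le> t" "F \<delta> t = 0"
    using IVT'[of "F \<delta>" h 0 1] K h(3) unfolding \<delta>_def by force
  then show thesis
    using that[of K t] K h(1) by (simp add: F_def \<delta>_def)
qed

section \<open>Choice of the integers and of the exponent\<close>

theorem theorem5p1:
  fixes x y :: "'a::{semilattice_inf,finite}"
    and ys :: "nat \<Rightarrow> 'a"
    and m n :: nat
  assumes "CARD('a) = n"
    and "m \<ge> 2"
    and "\<And>i. i \<in> {1..m} \<Longrightarrow> covers x (ys i)"
    and "y = Inf_fin (ys ` {1..m})"
    and "mobius y x > 0"
  shows "\<exists>(S :: nat set) (s :: nat \<Rightarrow> nat) (\<alpha>\<^sub>0 :: real).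
           inj_on s {..<n} \<and>
           S = s ` {..<n} \<and>
           (\<forall>i<n. 0 < s i) \<and>
           0 < \<alpha>\<^sub>0 \<and>
           poset_isomorphic S (dvd) (UNIV :: 'a set) (\<le>) \<and>
           \<not> invertible_mat (power_lcm_matrix n s \<alpha>\<^sub>0)"
proof -
  have "\<exists>i\<in>{1..m}. ys i \<noteq> ys 1"
  proof (rule ccontr)
    assume "\<not> ?thesis"
    then have "ys ` {1..m} = (\<lambda>_. ys 1) ` {1..m}" by (intro image_cong) blast+
    also have "\<dots> = {ys 1}" using \<open>m \<ge> 2\<close> by (simp add: image_constant_conv)
    finally have "y = ys 1" using assms(4) by simp
    then have "covers x y" using assms(3)[of 1] \<open>m \<ge> 2\<close> by simp
    then have "y < x" "{y..<x} = {y}" by (auto simp: covers_def order.order_iff_strict)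
    then have "mobius y x = - 1" by (simp add: mobius.simps[of y x])
    then show False using assms(5) by simp
  qed
  then obtain y\<^sub>1 y\<^sub>2 where cov: "covers x y\<^sub>1" "covers x y\<^sub>2" "y\<^sub>1 \<noteq> y\<^sub>2"
    using assms(2) assms(3)[of 1] assms(3) that by fastforce
  obtain p :: "'a \<Rightarrow> nat" where p: "inj p" "\<And>w. prime (p w)"
    using ex_inj_primes by blast
  have p1: "1 < p w" for w using p(2) by (rule prime_gt_1_nat)
  have lnp: "0 < ln (real (p w))" for w using p1[of w] by simp
  obtain K :: nat and t :: real where K: "0 < K" and t: "0 < t"
    and zero: "(\<Sum>j\<le>x. of_int (mobius j x) * exp (- t *
        (\<Sum>w\<le>j. (if w \<in> {y\<^sub>1, y\<^sub>2} then 1 else inverse (real K)) * ln (real (p w))))) = 0"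
    using sum_mobius_exp_root[OF cov, of "\<lambda>w. ln (real (p w))", OF lnp] .
  define a where "a w = (if w \<in> {y\<^sub>1, y\<^sub>2} then K else 1)" for w
  define f where "f z = (\<Prod>w\<le>z. p w ^ a w)" for z
  \<comment> \<open>This undoes the rescaling: \<open>\<alpha> * a w\<close> is \<open>t\<close>
    times the weight of \<open>w\<close> in \<open>zero\<close>.\<close>
  define \<alpha> where "\<alpha> = t / real K"
  have a: "0 < a w" for w using K by (simp add: a_def)
  have pos: "0 < f z" for z
    using p(2) by (auto simp: f_def prime_gt_0_nat intro!: prod_pos)
  have gcd: "gcd (f i) (f j) = f (inf i j)" for i j
    unfolding f_def
  proof (rule gcd_prod_atMost)
    fix v w :: 'a assume "v \<noteq> w"
    then have "p v \<noteq> p w" using p(1) by (simp add: inj_eq)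
    then show "coprime (p v ^ a v) (p w ^ a w)"
      using p(2) by (simp add: primes_coprime)
  qed
  have dvd: "f i dvd f j \<longleftrightarrow> i \<le> j" for i j
    unfolding f_def using p a by (rule prod_prime_powers_dvd_iff)
  have inj: "inj f"
    by (rule injI) (metis dvd dvd_refl order_antisym)
  have "real (f j) powr - \<alpha> = exp (- t *
      (\<Sum>w\<le>j. (if w \<in> {y\<^sub>1, y\<^sub>2} then 1 else inverse (real K)) * ln (real (p w))))" for j
  proof -
    have "ln (real (f j)) = (\<Sum>w\<le>j. real (a w) * ln (real (p w)))"
      unfolding f_def of_nat_prod using p(2)
      by (subst ln_prod) (auto simp: ln_realpow prime_gt_0_nat)
    also have "\<dots> = real K *
        (\<Sum>w\<le>j. (if w \<in> {y\<^sub>1, y\<^sub>2} then 1 else inverse (real K)) * ln (real (p w)))"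
      unfolding sum_distrib_left using K by (intro sum.cong) (auto simp: a_def)
    finally show ?thesis
      using pos[of j] K by (simp add: powr_def \<alpha>_def)
  qed
  then have zero': "(\<Sum>j\<le>x. of_int (mobius j x) * real (f j) powr - \<alpha>) = 0"
    using zero by simp
  obtain e where e: "bij_betw e {..<n} (UNIV :: 'a set)"
    using ex_bij_betw_nat_finite[of "UNIV :: 'a set"] assms(1) by (auto simp: atLeast0LessThan)
  have image: "(f \<circ> e) ` {..<n} = range f"
    using e by (metis bij_betw_def image_comp)
  have "poset_isomorphic ((f \<circ> e) ` {..<n}) (dvd) (UNIV :: 'a set) (\<le>)"
    unfolding image poset_isomorphic_def
  proof (intro exI conjI ballI)
    \<comment> \<open>The isomorphism has to go from the integers to the semilattice, hence the
      inverse of \<open>f\<close>.\<close>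
    show "bij_betw (inv_into UNIV f) (range f) UNIV"
      using inj by (simp add: bij_betw_inv_into inj_on_imp_bij_betw)
    show "u dvd v \<longleftrightarrow> inv_into UNIV f u \<le> inv_into UNIV f v" if "u \<in> range f" "v \<in> range f" for u v
      using that inj dvd by auto
  qed
  moreover have "inj_on (f \<circ> e) {..<n}"
    using e inj by (meson bij_betw_def comp_inj_on inj_on_subset subset_UNIV)
  moreover have "\<not> invertible_mat (power_lcm_matrix n (f \<circ> e) \<alpha>)"
    using e pos gcd zero' by (rule power_lcm_matrix_not_invertible)
  moreover have "0 < \<alpha>" using t K by (simp add: \<alpha>_def)
  ultimately show ?thesis
    using pos by (intro exI[of _ "(f \<circ> e) ` {..<n}"] exI[of _ "f \<circ> e"] exI[of _ \<alpha>]) auto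
qed

end
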